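(* Let $X:=\mathcal{K}(2^\omega)\setminus\{\emptyset\}$, $Y:=2^\omega$, and $A:=\{(K,x)\in X\times Y: x\in K\}$. Then $A$ is closed in $X\times Y$, all horizontal sections $\{K\in X: x\in K\}$ ($x\in Y$) are uncountable, the vertical sections $A_K=K$ are uncountable for all $K$ in a comeager subset of $X$, but if $F$ is a comeager Borel subset of $X$ and $G$ a comeager Borel subset of $Y$, there is no Borel isomorphism from $F$ onto $G$ whose graph is contained in $A$.
   Context: $\mathcal{K}(2^\omega)$ is the space of compact subsets of the Cantor space $2^\omega$ with the Vietoris (Hausdorff metric) topology. *)

theory Defs
  imports "HOL-Analysis.Analysis"
begin

(* On the type nat => bool, euclidean is the product topology of the discrete
   topologies on bool; see the lemma cantor_space_eq below. *)
abbreviation cantor_space :: "(nat \<Rightarrow> bool) topology" where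
  "cantor_space \<equiv> euclidean"

lemma cantor_space_eq:
  "cantor_space = product_topology (\<lambda>_. discrete_topology UNIV) UNIV"
proof -
  have "discrete_topology UNIV = (euclidean :: bool topology)"
    by (simp add: topology_eq open_discrete)
  then show ?thesis
    by (simp add: euclidean_product_topology)
qed

(* The space of all compact subsets of T, the empty set included. *)
definition vietoris :: "'a topology \<Rightarrow> 'a set topology" where
  "vietoris T = topology_generated_by
     ({{K. compactin T K \<and> K \<subseteq> U} | U. openin T U} \<union>
      {{K. compactin T K \<and> K \<inter> U \<noteq> {}} | U. openin T U})"

lemma topspace_vietoris [simp]: "topspace (vietoris T) = {K. compactin T K}"
proof
  show "topspace (vietoris T) \<subseteq> {K. compactin T K}"
    unfolding vietoris_def topology_generated_by_topspace by (rule Union_least) auto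
  have "{K. compactin T K} = {K. compactin T K \<and> K \<subseteq> topspace T}"
    using compactin_subset_topspace by (intro Collect_cong) blast
  then show "{K. compactin T K} \<subseteq> topspace (vietoris T)"
    unfolding vietoris_def topology_generated_by_topspace
    by (intro Union_upper UnI1 CollectI exI[of _ "topspace T"]) simp
qed

definition nowhere_dense_in :: "'a topology \<Rightarrow> 'a set \<Rightarrow> bool" where
  "nowhere_dense_in T S \<longleftrightarrow> S \<subseteq> topspace T \<and> T interior_of (T closure_of S) = {}"

definition meager_in :: "'a topology \<Rightarrow> 'a set \<Rightarrow> bool" where
  "meager_in T S \<longleftrightarrow> (\<exists>N :: nat \<Rightarrow> 'a set. (\<forall>n. nowhere_dense_in T (N n)) \<and> S = (\<Union>n. N n))"

definition comeager_in :: "'a topology \<Rightarrow> 'a set \<Rightarrow> bool" where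
  "comeager_in T S \<longleftrightarrow> S \<subseteq> topspace T \<and> meager_in T (topspace T - S)"

definition borel_of :: "'a topology \<Rightarrow> 'a measure" where
  "borel_of T = sigma (topspace T) {U. openin T U}"

definition borel_isomorphism :: "'a topology \<Rightarrow> 'b topology \<Rightarrow> ('a \<Rightarrow> 'b) \<Rightarrow> bool" where
  "borel_isomorphism S T f \<longleftrightarrow>
     bij_betw f (topspace S) (topspace T) \<and>
     f \<in> measurable (borel_of S) (borel_of T) \<and>
     the_inv_into (topspace S) f \<in> measurable (borel_of T) (borel_of S)"

end

theory Submission
  imports Defs
begin

text \<open>
  A meager set \<open>M \<subseteq> Y\<close> is missed by the generic compact set \<open>K\<close>.
  Suppose \<open>f : F \<rightarrow> G\<close> is a Borel isomorphism with \<open>f K \<in> K\<close>, and for an open \<open>V\<close> let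
  \<open>B\<^sub>V = {x \<in> G. x \<notin> V \<and> f\<inverse> x \<inter> V \<noteq> {}}\<close>. The generic \<open>K\<close> is not a singleton, so
  \<open>f K\<close> lies in \<open>B\<^sub>V\<close> for some \<open>V\<close> from a countable base. Since a generic \<open>K\<close> misses a given
  meager set, some \<open>B\<^sub>V\<close> is not meager; being Borel, it is comeager in a nonempty open \<open>W\<close>.
  A generic \<open>K \<subseteq> W\<close> then misses \<open>W - B\<^sub>V\<close>, so \<open>K \<subseteq> B\<^sub>V\<close> is disjoint from \<open>V\<close>; but
  \<open>f K \<in> B\<^sub>V\<close> says that \<open>K\<close> meets \<open>V\<close>.
\<close>

section \<open>Meager sets and the Baire property\<close>

lemma nowhere_dense_in_subset:
  assumes "nowhere_dense_in T S" "R \<subseteq> S"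
  shows "nowhere_dense_in T R"
  using assms closure_of_mono[of R S T] interior_of_mono[of "T closure_of R" "T closure_of S" T]
  unfolding nowhere_dense_in_def by auto

lemma nowhere_dense_in_closed:
  assumes "closedin T S" "T interior_of S = {}"
  shows "nowhere_dense_in T S"
  using assms by (simp add: nowhere_dense_in_def closedin_subset closure_of_closedin)

lemma meager_in_subset:
  assumes "meager_in T S" "R \<subseteq> S"
  shows "meager_in T R"
proof -
  obtain N :: "nat \<Rightarrow> 'a set" where N: "\<And>n. nowhere_dense_in T (N n)" "S = (\<Union>n. N n)"
    using assms(1) unfolding meager_in_def by auto
  have "R = (\<Union>n. N n \<inter> R)"
    using assms(2) N(2) by auto
  then show ?thesis
    unfolding meager_in_def using nowhere_dense_in_subset[OF N(1)] by (metis inf_le1)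
qed

lemma nowhere_dense_imp_meager_in: "nowhere_dense_in T S \<Longrightarrow> meager_in T S"
  unfolding meager_in_def by (rule exI[of _ "\<lambda>_. S"]) auto

lemma meager_in_empty: "meager_in T {}"
  by (rule nowhere_dense_imp_meager_in) (simp add: nowhere_dense_in_def)

text \<open>One sequence of nowhere dense sets is chosen per index, and the resulting double family
  is flattened along the pairing \<open>prod_decode\<close>. \<open>I\<close> is enumerated by
  \<open>from_nat_into\<close>, which stays inside \<open>I\<close> only if \<open>I\<close> is
  nonempty.\<close>

lemma meager_in_UN:
  assumes "countable I" "\<And>i. i \<in> I \<Longrightarrow> meager_in T (S i)"
  shows "meager_in T (\<Union>i\<in>I. S i)"
proof (cases "I = {}")
  case False
  have "\<forall>i\<in>I. \<exists>N :: nat \<Rightarrow> 'b set. (\<forall>n. nowhere_dense_in T (N n)) \<and> S i = (\<Union>n. N n)"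
    using assms(2) unfolding meager_in_def by auto
  then obtain N :: "'a \<Rightarrow> nat \<Rightarrow> 'b set"
    where N: "\<And>i n. i \<in> I \<Longrightarrow> nowhere_dense_in T (N i n)" "\<And>i. i \<in> I \<Longrightarrow> S i = (\<Union>n. N i n)"
    unfolding bchoice_iff by blast
  define P where "P k = N (from_nat_into I (fst (prod_decode k))) (snd (prod_decode k))" for k
  have "(\<Union>i\<in>I. S i) = (\<Union>k. P k)"
  proof
    show "(\<Union>k. P k) \<subseteq> (\<Union>i\<in>I. S i)"
      unfolding P_def using N(2) from_nat_into[OF False] by blast
    show "(\<Union>i\<in>I. S i) \<subseteq> (\<Union>k. P k)"
    proof
      fix x assume "x \<in> (\<Union>i\<in>I. S i)"
      then obtain i n where "i \<in> I" "x \<in> N i n"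
        using N(2) by blast
      then have "x \<in> P (prod_encode (to_nat_on I i, n))"
        by (simp add: P_def assms(1))
      then show "x \<in> (\<Union>k. P k)" by blast
    qed
  qed
  moreover have "nowhere_dense_in T (P k)" for k
    unfolding P_def using N(1) from_nat_into[OF False] by blast
  ultimately show ?thesis
    unfolding meager_in_def by blast
qed (simp add: meager_in_empty)

lemma meager_in_Un:
  assumes "meager_in T R" "meager_in T S"
  shows "meager_in T (R \<union> S)"
proof -
  have "meager_in T (\<Union>b. if b then R else S)"
    by (intro meager_in_UN) (auto simp: assms)
  then show ?thesis by (auto simp: UNIV_bool Un_commute)
qed

lemma comeager_in_Int:
  assumes "comeager_in T R" "comeager_in T S"
  shows "comeager_in T (R \<inter> S)"
  using assms meager_in_Un[of T "topspace T - R" "topspace T - S"]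
  unfolding comeager_in_def by (auto simp: Diff_Int)

text \<open>Baire category: an open set missed by \<open>S\<close> would lie in the union of the
  closures of countably many nowhere dense sets, whose interior is empty.\<close>

lemma comeager_meets_open:
  assumes "locally_compact_space T" "regular_space T"
    and "comeager_in T S" "openin T U" "U \<noteq> {}"
  shows "U \<inter> S \<noteq> {}"
proof
  assume "U \<inter> S = {}"
  obtain N :: "nat \<Rightarrow> 'a set"
    where N: "\<And>n. nowhere_dense_in T (N n)" "topspace T - S = (\<Union>n. N n)"
    using assms(3) unfolding comeager_in_def meager_in_def by auto
  have "T interior_of (\<Union>(range (\<lambda>n. T closure_of N n))) = {}"
    by (rule Baire_category_alt) (use assms N(1) in \<open>auto simp: nowhere_dense_in_def\<close>)
  moreover have "U \<subseteq> (\<Union>n. N n)"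
    using \<open>U \<inter> S = {}\<close> openin_subset[OF assms(4)] N(2) by auto
  moreover have "N n \<subseteq> T closure_of N n" for n
    using N(1) by (simp add: closure_of_subset nowhere_dense_in_def)
  ultimately have "U \<subseteq> T interior_of (\<Union>(range (\<lambda>n. T closure_of N n)))"
    by (intro interior_of_maximal assms(4)) blast
  then show False
    using \<open>T interior_of _ = {}\<close> assms(5) by auto
qed

section \<open>Sets that are open modulo a meager set\<close>

definition baire_property_in :: "'a topology \<Rightarrow> 'a set \<Rightarrow> bool" where
  "baire_property_in T S \<longleftrightarrow> S \<subseteq> topspace T \<and>
     (\<exists>U. openin T U \<and> meager_in T (S - U) \<and> meager_in T (U - S))"

lemma baire_property_in_open: "openin T U \<Longrightarrow> baire_property_in T U"
  unfolding baire_property_in_def using meager_in_empty openin_subset by (metis Diff_cancel)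

lemma baire_property_in_comeager: "comeager_in T S \<Longrightarrow> baire_property_in T S"
  unfolding baire_property_in_def comeager_in_def
  by (intro conjI exI[of _ "topspace T"]) (auto intro: meager_in_subset[OF meager_in_empty])

text \<open>The open set for the complement is the interior of \<open>topspace T - U\<close>. A
  closed set exceeds its interior only by a nowhere dense set, so the error stays meager.\<close>

lemma baire_property_in_compl:
  assumes "baire_property_in T S"
  shows "baire_property_in T (topspace T - S)"
proof -
  obtain U where U: "openin T U" "meager_in T (S - U)" "meager_in T (U - S)"
    using assms unfolding baire_property_in_def by auto
  let ?C = "topspace T - U"
  have C: "closedin T ?C"
    using U(1) by blast
  have "closedin T (?C - T interior_of ?C)"
    using C by (simp add: closedin_diff)
  moreover have "T interior_of (?C - T interior_of ?C) = {}"
    using interior_of_mono[of "?C - T interior_of ?C" ?C T]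
      interior_of_subset[of T "?C - T interior_of ?C"] by blast
  ultimately have N: "meager_in T (?C - T interior_of ?C)"
    by (intro nowhere_dense_imp_meager_in nowhere_dense_in_closed)
  have "meager_in T ((topspace T - S) - T interior_of ?C)"
    by (rule meager_in_subset[OF meager_in_Un[OF N U(3)]]) auto
  moreover have "meager_in T (T interior_of ?C - (topspace T - S))"
    by (rule meager_in_subset[OF U(2)]) (use interior_of_subset[of T ?C] in auto)
  ultimately show ?thesis
    unfolding baire_property_in_def by (intro conjI exI[of _ "T interior_of ?C"]) auto
qed

lemma baire_property_in_UN:
  fixes S :: "nat \<Rightarrow> 'a set"
  assumes "\<And>n. baire_property_in T (S n)"
  shows "baire_property_in T (\<Union>n. S n)"
proof -
  obtain U where U: "\<And>n. openin T (U n)" "\<And>n. meager_in T (S n - U n)" "\<And>n. meager_in T (U n - S n)"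
    using assms unfolding baire_property_in_def by metis
  have "meager_in T ((\<Union>n. S n) - (\<Union>n. U n))"
    by (rule meager_in_subset[OF meager_in_UN[of UNIV T "\<lambda>n. S n - U n"]]) (use U in auto)
  moreover have "meager_in T ((\<Union>n. U n) - (\<Union>n. S n))"
    by (rule meager_in_subset[OF meager_in_UN[of UNIV T "\<lambda>n. U n - S n"]]) (use U in auto)
  moreover have "(\<Union>n. S n) \<subseteq> topspace T"
    using assms unfolding baire_property_in_def by blast
  moreover have "openin T (\<Union>n. U n)"
    using U(1) by blast
  ultimately show ?thesis
    unfolding baire_property_in_def by (intro conjI exI[of _ "\<Union>n. U n"])
qed

lemma baire_property_in_Int:
  assumes "baire_property_in T R" "baire_property_in T S"
  shows "baire_property_in T (R \<inter> S)"
proof -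
  let ?c = "\<lambda>A. topspace T - A"
  \<comment> \<open>De Morgan: the union of the two complements is written as a sequence that is
    constant from index 1 on.\<close>
  have "baire_property_in T (?c (\<Union>n. if n = (0::nat) then ?c R else ?c S))"
    by (intro baire_property_in_compl baire_property_in_UN) (simp add: assms baire_property_in_compl)
  moreover have "?c (\<Union>n. if n = (0::nat) then ?c R else ?c S) = R \<inter> S"
    using assms unfolding baire_property_in_def by (auto split: if_splits)
  ultimately show ?thesis by simp
qed

text \<open>The Borel sets of the subspace are generated by the traces \<open>U \<inter> G\<close>,
  which inherit the property from \<open>U\<close> and \<open>G\<close>. Complements are relative to
  \<open>G\<close>, hence are intersections of \<open>G\<close> with complements in
  \<open>T\<close>.\<close>

lemma baire_property_in_borel_of_subtopology:
  assumes "baire_property_in T G" "S \<in> sets (borel_of (subtopology T G))"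
  shows "baire_property_in T S"
proof -
  have G: "topspace (subtopology T G) = G"
    using assms(1) unfolding baire_property_in_def by auto
  have "S \<in> sigma_sets G {U. openin (subtopology T G) U}"
    using assms(2) openin_subset[of "subtopology T G"] unfolding borel_of_def G
    by (subst (asm) sets_measure_of) auto
  then show ?thesis
  proof induction
    case (Basic S)
    then obtain U where "openin T U" "S = U \<inter> G"
      by (auto simp: openin_subtopology)
    then show ?case
      by (simp add: baire_property_in_Int baire_property_in_open assms(1))
  next
    case Empty
    show ?case by (simp add: baire_property_in_open)
  next
    case (Compl S)
    have "G - S = G \<inter> (topspace T - S)"
      using assms(1) unfolding baire_property_in_def by auto
    then show ?case
      by (simp add: Compl.IH assms(1) baire_property_in_Int baire_property_in_compl)
  next
    case (Union S)
    then show ?case by (intro baire_property_in_UN)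
  qed
qed

section \<open>The hyperspace of nonempty compact sets\<close>

abbreviation hyperspace :: "'a topology \<Rightarrow> 'a set topology" where
  "hyperspace T \<equiv> subtopology (vietoris T) (topspace (vietoris T) - {{}})"

lemma openin_vietoris_subset:
  assumes "openin T U"
  shows "openin (vietoris T) {K. compactin T K \<and> K \<subseteq> U}"
  unfolding vietoris_def
  by (rule topology_generated_by_Basis, rule UnI1, rule CollectI) (use assms in auto)

lemma openin_vietoris_meets:
  assumes "openin T U"
  shows "openin (vietoris T) {K. compactin T K \<and> K \<inter> U \<noteq> {}}"
  unfolding vietoris_def
  by (rule topology_generated_by_Basis, rule UnI2, rule CollectI) (use assms in auto)

lemma openin_hyperspace_subset:
  assumes "openin T U"
  shows "openin (hyperspace T) {K. compactin T K \<and> K \<noteq> {} \<and> K \<subseteq> U}"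
  unfolding openin_subtopology
  by (intro exI[of _ "{K. compactin T K \<and> K \<subseteq> U}"] conjI openin_vietoris_subset assms) auto

lemma openin_hyperspace_meets:
  assumes "openin T U"
  shows "openin (hyperspace T) {K. compactin T K \<and> K \<inter> U \<noteq> {}}"
  unfolding openin_subtopology
  by (intro exI[of _ "{K. compactin T K \<and> K \<inter> U \<noteq> {}}"] conjI openin_vietoris_meets assms) auto

text \<open>Induction on the generation of the topology. Containment conditions merge into one by
  intersecting the sets \<open>U\<close>; hitting conditions do not merge, so they are collected in
  a finite family.\<close>

lemma vietoris_basic_neighbourhood:
  assumes "openin (vietoris T) \<U>" "K \<in> \<U>"
  obtains U \<V> where "openin T U" "K \<subseteq> U" "finite \<V>" "\<forall>V\<in>\<V>. openin T V \<and> K \<inter> V \<noteq> {}"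
    "\<forall>L. compactin T L \<longrightarrow> L \<subseteq> U \<longrightarrow> (\<forall>V\<in>\<V>. L \<inter> V \<noteq> {}) \<longrightarrow> L \<in> \<U>"
proof -
  let ?nbhd = "\<lambda>U \<V> \<U>. openin T U \<and> K \<subseteq> U \<and> finite \<V> \<and> (\<forall>V\<in>\<V>. openin T V \<and> K \<inter> V \<noteq> {}) \<and>
    (\<forall>L. compactin T L \<longrightarrow> L \<subseteq> U \<longrightarrow> (\<forall>V\<in>\<V>. L \<inter> V \<noteq> {}) \<longrightarrow> L \<in> \<U>)"
  have K: "K \<subseteq> topspace T"
    using assms openin_subset[OF assms(1)] compactin_subset_topspace by auto
  have "generate_topology_on
     ({{K. compactin T K \<and> K \<subseteq> U} | U. openin T U} \<union>
      {{K. compactin T K \<and> K \<inter> U \<noteq> {}} | U. openin T U}) \<U>"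
    using assms(1) unfolding vietoris_def by (rule openin_topology_generated_by)
  then have "\<exists>U \<V>. ?nbhd U \<V> \<U>"
    using assms(2)
  proof induction
    case Empty
    then show ?case by simp
  next
    case (Int a b)
    then have "K \<in> a" "K \<in> b" by auto
    then obtain U \<V> U' \<V>' where n: "?nbhd U \<V> a" "?nbhd U' \<V>' b"
      using Int.IH(1)[OF \<open>K \<in> a\<close>] Int.IH(2)[OF \<open>K \<in> b\<close>] by (elim exE) (rule that)
    show ?case
      by (intro exI[of _ "U \<inter> U'"] exI[of _ "\<V> \<union> \<V>'"]) (use n in auto)
  next
    case (UN \<K>)
    then obtain k where k: "k \<in> \<K>" "K \<in> k" by auto
    obtain U \<V> where n: "?nbhd U \<V> k"
      using UN.IH[OF k] by (elim exE) (rule that)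
    show ?case
      by (intro exI[of _ U] exI[of _ \<V>]) (use n k(1) in auto)
  next
    case (Basis s)
    then consider W where "openin T W" "s = {K. compactin T K \<and> K \<subseteq> W}"
      | W where "openin T W" "s = {K. compactin T K \<and> K \<inter> W \<noteq> {}}"
      by auto
    then show ?case
    proof cases
      case 1
      then show ?thesis
        using Basis.prems by (intro exI[of _ W] exI[of _ "{}"]) auto
    next
      case 2
      \<comment> \<open>A compact set always lies in \<open>topspace T\<close>, so this choice of
        \<open>U\<close> imposes no condition.\<close>
      then show ?thesis
        using Basis.prems K by (intro exI[of _ "topspace T"] exI[of _ "{W}"]) auto
    qed
  qed
  then obtain U \<V> where "?nbhd U \<V> \<U>" by (elim exE) (rule that)
  then show thesis
    by (intro that[of U \<V>]) auto
qed

lemma hyperspace_basic_neighbourhood: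
  assumes "openin (hyperspace T) \<U>" "K \<in> \<U>"
  obtains U \<V> where "openin T U" "K \<subseteq> U" "finite \<V>" "\<forall>V\<in>\<V>. openin T V \<and> K \<inter> V \<noteq> {}"
    "\<forall>L. compactin T L \<longrightarrow> L \<noteq> {} \<longrightarrow> L \<subseteq> U \<longrightarrow> (\<forall>V\<in>\<V>. L \<inter> V \<noteq> {}) \<longrightarrow> L \<in> \<U>"
proof -
  obtain \<W> where W: "openin (vietoris T) \<W>" "\<U> = \<W> \<inter> (topspace (vietoris T) - {{}})"
    using assms(1) unfolding openin_subtopology by blast
  then have "K \<in> \<W>" using assms(2) by blast
  from vietoris_basic_neighbourhood[OF W(1) this] obtain U \<V>
    where U: "openin T U" "K \<subseteq> U" "finite \<V>" "\<forall>V\<in>\<V>. openin T V \<and> K \<inter> V \<noteq> {}"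
      and L: "\<forall>L. compactin T L \<longrightarrow> L \<subseteq> U \<longrightarrow> (\<forall>V\<in>\<V>. L \<inter> V \<noteq> {}) \<longrightarrow> L \<in> \<W>" .
  show thesis
    by (rule that[OF U]) (use L W(2) in auto)
qed

section \<open>Compactness and separation in the hyperspace\<close>

text \<open>Bridges to the form of a generated topology in which \<open>Alexander_subbase\<close> is
  stated.\<close>

lemma topology_generated_by_eq_subbase:
  "topology_generated_by \<B> = topology (arbitrary union_of (finite intersection_of (\<lambda>x. x \<in> \<B>) relative_to \<Union>\<B>))"
  (is "?L = ?R")
  unfolding topology_eq
proof (intro allI iffI)
  fix S
  assume "openin ?L S"
  then have "generate_topology_on \<B> S"
    by (rule openin_topology_generated_by)
  moreover have "openin ?R s" if "s \<in> \<B>" for s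
  proof -
    have "(finite intersection_of (\<lambda>x. x \<in> \<B>) relative_to \<Union>\<B>) (\<Union>\<B> \<inter> s)"
      using that by (intro relative_to_inc finite_intersection_of_inc)
    moreover have "\<Union>\<B> \<inter> s = s" using that by blast
    ultimately show ?thesis
      unfolding openin_subbase by (intro arbitrary_union_of_inc) simp
  qed
  ultimately show "openin ?R S"
    using generate_topology_on_coarsest[of "openin ?R" \<B> S] by simp
next
  fix S
  assume "openin ?R S"
  then show "openin ?L S"
    by (rule minimal_topology_subbase[rotated 2])
      (use openin_topspace[of ?L] in \<open>auto intro: topology_generated_by_Basis\<close>)
qed

text \<open>By Alexander's theorem only covers \<open>C\<close> by subbasic sets matter. The set
  \<open>K\<close> left over by the hitting conditions lies in a member \<open>?S U\<close> of
  \<open>C\<close>, so \<open>U\<close> and \<open>\<M>\<close> cover \<open>T\<close>. A finite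
  subcover of \<open>T\<close> suffices: a compact set inside \<open>U\<close> belongs to
  \<open>?S U\<close>, any other one meets a remaining set of the subcover.\<close>

lemma compact_space_vietoris:
  assumes "compact_space T"
  shows "compact_space (vietoris T)"
proof -
  let ?S = "\<lambda>U. {K. compactin T K \<and> K \<subseteq> U}" and ?M = "\<lambda>U. {K. compactin T K \<and> K \<inter> U \<noteq> {}}"
  let ?\<B> = "{?S U | U. openin T U} \<union> {?M U | U. openin T U}"
  show ?thesis
  proof (rule Alexander_subbase[where \<B> = ?\<B>])
    show "topology (arbitrary union_of (finite intersection_of (\<lambda>x. x \<in> ?\<B>) relative_to \<Union>?\<B>)) = vietoris T"
      unfolding vietoris_def by (rule topology_generated_by_eq_subbase[symmetric])
    fix C assume C: "C \<subseteq> ?\<B>" "\<Union>C = topspace (vietoris T)"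
    define \<M> where "\<M> = {U. openin T U \<and> ?M U \<in> C}"
    \<comment> \<open>The largest compact set not covered by the members of \<open>C\<close> of the form \<open>?M U\<close>.\<close>
    define K where "K = topspace T - \<Union>\<M>"
    have "closedin T K"
      unfolding K_def \<M>_def by (intro closedin_diff closedin_topspace openin_Union) auto
    then have "compactin T K"
      using assms by (simp add: closedin_compact_space)
    then obtain c where c: "c \<in> C" "K \<in> c"
      using C(2) by auto
    \<comment> \<open>If \<open>c\<close> were \<open>?M U\<close>, then
      \<open>U \<in> \<M>\<close>, but \<open>K\<close> avoids every member of
      \<open>\<M>\<close>.\<close>
    have "\<not> (\<exists>U. openin T U \<and> c = ?M U)"
      using c by (auto simp: K_def \<M>_def)
    moreover have "c \<in> ?\<B>" using c(1) C(1) by (rule rev_subsetD)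
    ultimately obtain U where U: "openin T U" "c = ?S U"
      by auto
    have "compactin T (topspace T)"
      using assms by (simp add: compact_space_def)
    moreover have "\<forall>V\<in>insert U \<M>. openin T V"
      using U(1) by (auto simp: \<M>_def)
    moreover have "topspace T \<subseteq> \<Union>(insert U \<M>)"
      using c(2) U(2) by (auto simp: K_def)
    ultimately obtain \<F> where F: "finite \<F>" "\<F> \<subseteq> insert U \<M>" "topspace T \<subseteq> \<Union>\<F>"
      unfolding compactin_def by meson
    let ?C' = "insert c (?M ` (\<F> - {U}))"
    have "finite ?C'" "?C' \<subseteq> C"
      using F c(1) by (auto simp: \<M>_def)
    moreover have "topspace (vietoris T) \<subseteq> \<Union>?C'"
    proof
      fix L assume "L \<in> topspace (vietoris T)"
      then have L: "compactin T L" "L \<subseteq> topspace T"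
        by (auto dest: compactin_subset_topspace)
      show "L \<in> \<Union>?C'"
      proof (cases "L \<subseteq> U")
        case True
        then show ?thesis using L(1) U(2) by auto
      next
        case False
        then obtain x V where "x \<in> L" "x \<in> V" "V \<in> \<F> - {U}"
          using L(2) F(3) by blast
        then show ?thesis using L(1) by blast
      qed
    qed
    moreover have "\<Union>?C' \<subseteq> topspace (vietoris T)"
      using Union_mono[OF \<open>?C' \<subseteq> C\<close>] C(2) by (rule subset_trans[OF _ equalityD1])
    ultimately show "\<exists>C'. finite C' \<and> C' \<subseteq> C \<and> \<Union>C' = topspace (vietoris T)"
      by (intro exI[of _ ?C'] conjI subset_antisym)
  qed
qed

text \<open>A point of \<open>K\<close> outside \<open>L\<close> is separated from \<open>L\<close>
  by disjoint open sets \<open>U\<close> and \<open>V\<close>; then no set meets \<open>U\<close>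
  and lies in \<open>V\<close>. For \<open>K \<noteq> L\<close> such a point exists in one direction
  or the other.\<close>

lemma Hausdorff_space_vietoris:
  assumes "Hausdorff_space T"
  shows "Hausdorff_space (vietoris T)"
proof -
  have sep: "\<exists>\<U> \<V>. openin (vietoris T) \<U> \<and> openin (vietoris T) \<V> \<and> K \<in> \<U> \<and> L \<in> \<V> \<and> disjnt \<U> \<V>"
    if KL: "compactin T K" "compactin T L" and "\<not> K \<subseteq> L" for K L
  proof -
    obtain x where x: "x \<in> K" "x \<notin> L" using \<open>\<not> K \<subseteq> L\<close> by blast
    then have "compactin T {x}"
      using KL(1) compactin_subset_topspace by fastforce
    then obtain U V where UV: "openin T U" "openin T V" "{x} \<subseteq> U" "L \<subseteq> V" "disjnt U V"
      using assms KL(2) x(2) unfolding Hausdorff_space_compact_sets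
      by (metis disjnt_insert1 disjnt_empty1)
    have "openin (vietoris T) {K. compactin T K \<and> K \<inter> U \<noteq> {}}"
      "openin (vietoris T) {K. compactin T K \<and> K \<subseteq> V}"
      using UV by (simp_all add: openin_vietoris_meets openin_vietoris_subset)
    then show ?thesis
      using UV x KL
      by (intro exI[of _ "{K. compactin T K \<and> K \<inter> U \<noteq> {}}"] exI[of _ "{K. compactin T K \<and> K \<subseteq> V}"])
        (auto simp: disjnt_iff)
  qed
  show ?thesis
    unfolding Hausdorff_space_def
  proof (intro allI impI)
    fix K L assume KL: "K \<in> topspace (vietoris T) \<and> L \<in> topspace (vietoris T) \<and> K \<noteq> L"
    then consider "\<not> K \<subseteq> L" | "\<not> L \<subseteq> K" by blast
    then show "\<exists>\<U> \<V>. openin (vietoris T) \<U> \<and> openin (vietoris T) \<V> \<and> K \<in> \<U> \<and> L \<in> \<V> \<and> disjnt \<U> \<V>"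
    proof cases
      case 1
      then show ?thesis using sep[of K L] KL by simp
    next
      case 2
      then obtain \<U> \<V> where "openin (vietoris T) \<U>" "openin (vietoris T) \<V>" "L \<in> \<U>" "K \<in> \<V>" "disjnt \<U> \<V>"
        using sep[of L K] KL by auto
      then show ?thesis using disjnt_sym by blast
    qed
  qed
qed

text \<open>The empty set is an isolated point, being the only set contained in the open set
  \<open>{}\<close>. Hence the hyperspace is closed in a compact Hausdorff space, and Baire category
  applies to it.\<close>

lemma hyperspace_locally_compact_regular:
  assumes "compact_space T" "Hausdorff_space T"
  shows "locally_compact_space (hyperspace T)" "regular_space (hyperspace T)"
proof -
  have "openin (vietoris T) {K. compactin T K \<and> K \<subseteq> {}}"
    by (rule openin_vietoris_subset) simp
  moreover have "{K. compactin T K \<and> K \<subseteq> {}} = {{}}" by auto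
  ultimately have "closedin (vietoris T) (topspace (vietoris T) - {{}})"
    by (metis closedin_diff closedin_topspace)
  then have "compact_space (hyperspace T)"
    using assms by (intro compact_space_subtopology closedin_compact_space compact_space_vietoris)
  moreover have "Hausdorff_space (hyperspace T)"
    using assms by (intro Hausdorff_space_subtopology Hausdorff_space_vietoris)
  ultimately show "locally_compact_space (hyperspace T)" "regular_space (hyperspace T)"
    by (auto intro: compact_imp_locally_compact_space compact_Hausdorff_imp_regular_space)
qed

text \<open>If \<open>x \<notin> K\<close>, disjoint open sets around \<open>x\<close> and
  \<open>K\<close> keep all nearby points out of all nearby compact sets.\<close>

lemma closedin_membership:
  assumes "Hausdorff_space T"
  shows "closedin (prod_topology (hyperspace T) T) {(K, x). K \<in> topspace (hyperspace T) \<and> x \<in> K}"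
    (is "closedin ?P ?A")
proof -
  have "openin ?P (topspace ?P - ?A)"
    unfolding openin_prod_topology_alt
  proof (intro allI impI)
    fix K x assume "(K, x) \<in> topspace ?P - ?A"
    then have K: "compactin T K" "K \<noteq> {}" and x: "x \<in> topspace T" "x \<notin> K"
      by auto
    then obtain U V where UV: "openin T U" "openin T V" "{x} \<subseteq> U" "K \<subseteq> V" "disjnt U V"
      using assms unfolding Hausdorff_space_compact_sets
      by (metis disjnt_insert1 disjnt_empty1 compactin_sing)
    show "\<exists>\<U> W. openin (hyperspace T) \<U> \<and> openin T W \<and> K \<in> \<U> \<and> x \<in> W \<and> \<U> \<times> W \<subseteq> topspace ?P - ?A"
      using UV K x openin_hyperspace_subset[OF UV(2)] openin_subset[OF UV(1)]
      by (intro exI[of _ "{K. compactin T K \<and> K \<noteq> {} \<and> K \<subseteq> V}"] exI[of _ U])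
        (auto simp: disjnt_iff)
  qed
  moreover have "?A \<subseteq> topspace ?P"
    using compactin_subset_topspace by fastforce
  ultimately show ?thesis
    unfolding closedin_def by blast
qed

section \<open>Generic compact sets\<close>

text \<open>For nowhere dense \<open>N n\<close>, the sets meeting its closure form a closed set
  without interior: each basic neighbourhood contains a finite set of points chosen off that
  closure.\<close>

lemma comeager_in_hyperspace_disjoint_meager:
  assumes "meager_in T M"
  shows "comeager_in (hyperspace T) {K \<in> topspace (hyperspace T). K \<inter> M = {}}"
proof -
  obtain N :: "nat \<Rightarrow> 'a set" where N: "\<And>n. nowhere_dense_in T (N n)" "M = (\<Union>n. N n)"
    using assms unfolding meager_in_def by auto
  have "nowhere_dense_in (hyperspace T) {K \<in> topspace (hyperspace T). K \<inter> T closure_of N n \<noteq> {}}"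
    (is "nowhere_dense_in _ ?E") for n
  proof (rule nowhere_dense_in_closed)
    let ?O = "topspace T - T closure_of N n"
    have O: "openin T ?O"
      by (simp add: openin_diff)
    have E: "?E = topspace (hyperspace T) - {K. compactin T K \<and> K \<noteq> {} \<and> K \<subseteq> ?O}"
      using compactin_subset_topspace by fastforce
    show "closedin (hyperspace T) ?E"
      unfolding E by (intro closedin_diff closedin_topspace openin_hyperspace_subset O)
    show "hyperspace T interior_of ?E = {}"
    proof (rule ccontr)
      assume "hyperspace T interior_of ?E \<noteq> {}"
      then obtain K where K: "K \<in> hyperspace T interior_of ?E" by blast
      obtain U \<V> where U: "openin T U" "K \<subseteq> U" "finite \<V>"
        "\<forall>V\<in>\<V>. openin T V \<and> K \<inter> V \<noteq> {}"
        and L: "\<forall>L. compactin T L \<longrightarrow> L \<noteq> {} \<longrightarrow> L \<subseteq> U \<longrightarrow> (\<forall>V\<in>\<V>. L \<inter> V \<noteq> {})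
           \<longrightarrow> L \<in> hyperspace T interior_of ?E"
        by (rule hyperspace_basic_neighbourhood[OF openin_interior_of K])
      have "K \<noteq> {}"
        using K interior_of_subset[of "hyperspace T" ?E] by auto
      \<comment> \<open>Inserting \<open>U\<close> makes the finite set below nonempty even if
        \<open>\<V>\<close> is empty.\<close>
      let ?\<W> = "insert U \<V>"
      have "\<exists>y. y \<in> U \<inter> V \<and> y \<notin> T closure_of N n" if "V \<in> ?\<W>" for V
      proof (rule ccontr)
        assume "\<not> ?thesis"
        moreover have "openin T (U \<inter> V)" "U \<inter> V \<noteq> {}"
          using that U \<open>K \<noteq> {}\<close> by blast+
        ultimately have "U \<inter> V \<subseteq> T interior_of (T closure_of N n)"
          by (intro interior_of_maximal) auto
        then show False
          using N(1)[of n] \<open>U \<inter> V \<noteq> {}\<close> unfolding nowhere_dense_in_def by auto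
      qed
      then obtain y where y: "\<And>V. V \<in> ?\<W> \<Longrightarrow> y V \<in> U \<inter> V \<and> y V \<notin> T closure_of N n"
        by metis
      have "y ` ?\<W> \<in> hyperspace T interior_of ?E"
      proof (rule L[rule_format])
        show "compactin T (y ` ?\<W>)"
          using U y openin_subset[OF U(1)] by (intro finite_imp_compactin) auto
      qed (use y in auto)
      then show False
        using y interior_of_subset[of "hyperspace T" ?E] by auto
    qed
  qed
  then have "meager_in (hyperspace T) (\<Union>n. {K \<in> topspace (hyperspace T). K \<inter> T closure_of N n \<noteq> {}})"
    by (intro meager_in_UN nowhere_dense_imp_meager_in) auto
  moreover have "N n \<subseteq> T closure_of N n" for n
    using N(1) by (simp add: closure_of_subset nowhere_dense_in_def)
  then have "topspace (hyperspace T) - {K \<in> topspace (hyperspace T). K \<inter> M = {}} \<subseteq>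
      (\<Union>n. {K \<in> topspace (hyperspace T). K \<inter> T closure_of N n \<noteq> {}})"
    using N(2) by fastforce
  ultimately show ?thesis
    unfolding comeager_in_def by (auto intro: meager_in_subset)
qed

text \<open>A compact set that is not perfect has an isolated point, so it meets some basic open
  \<open>V\<close> in exactly one point and lies in \<open>E V\<close>. Each \<open>E V\<close> is
  nowhere dense: in a perfect space a second point of \<open>V\<close> can be added, and having two
  points in \<open>V\<close> survives small changes.\<close>

lemma comeager_in_hyperspace_perfect:
  assumes "Hausdorff_space T" "second_countable T"
    and perfect: "T derived_set_of topspace T = topspace T"
  shows "comeager_in (hyperspace T) {K \<in> topspace (hyperspace T). T derived_set_of K = K}"
proof -
  obtain \<B> where \<B>: "countable \<B>" "\<And>V. V \<in> \<B> \<Longrightarrow> openin T V"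
    "\<And>U x. openin T U \<Longrightarrow> x \<in> U \<Longrightarrow> \<exists>V\<in>\<B>. x \<in> V \<and> V \<subseteq> U"
    using assms(2) unfolding second_countable_def by metis
  define E where "E V = {K \<in> topspace (hyperspace T). \<exists>x. K \<inter> V = {x}}" for V
  have nd: "nowhere_dense_in (hyperspace T) (E V)" if "openin T V" for V
    unfolding nowhere_dense_in_def
  proof
    show "E V \<subseteq> topspace (hyperspace T)"
      by (auto simp: E_def)
    show "hyperspace T interior_of (hyperspace T closure_of E V) = {}"
    proof (rule ccontr)
      assume "\<not> ?thesis"
      \<comment> \<open>An open set meeting the closure of \<open>E V\<close> meets
        \<open>E V\<close> itself, which supplies an actual \<open>K\<close> with a single point in
        \<open>V\<close>.\<close>
      then have "hyperspace T interior_of (hyperspace T closure_of E V) \<inter> E V \<noteq> {}"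
        using openin_Int_closure_of_eq_empty[OF openin_interior_of, of "hyperspace T" "hyperspace T closure_of E V" "E V"]
          interior_of_subset[of "hyperspace T" "hyperspace T closure_of E V"] by blast
      then obtain K x where K: "K \<in> hyperspace T interior_of (hyperspace T closure_of E V)"
        "compactin T K" and x: "K \<inter> V = {x}"
        by (auto simp: E_def)
      obtain U \<V> where U: "openin T U" "K \<subseteq> U" "finite \<V>"
        "\<forall>V\<in>\<V>. openin T V \<and> K \<inter> V \<noteq> {}"
        and L: "\<forall>L. compactin T L \<longrightarrow> L \<noteq> {} \<longrightarrow> L \<subseteq> U \<longrightarrow> (\<forall>V\<in>\<V>. L \<inter> V \<noteq> {})
           \<longrightarrow> L \<in> hyperspace T interior_of (hyperspace T closure_of E V)"
        by (rule hyperspace_basic_neighbourhood[OF openin_interior_of K(1)])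
      have "x \<in> T derived_set_of topspace T" "x \<in> U \<inter> V" "openin T (U \<inter> V)"
        using x U \<open>openin T V\<close> openin_subset[OF that] perfect by auto
      then obtain y where y: "y \<noteq> x" "y \<in> U \<inter> V" "y \<in> topspace T"
        unfolding in_derived_set_of by blast
      have "compactin T (insert y K)"
        using compactin_Un[of T "{y}" K] y K(2) by simp
      \<comment> \<open>Adding \<open>y\<close> preserves every hitting condition, and
        \<open>y \<in> U\<close> preserves containment.\<close>
      then have 1: "insert y K \<in> hyperspace T closure_of E V"
        using U y x by (intro subsetD[OF interior_of_subset L[rule_format]]) auto
      obtain P Q where PQ: "openin T P" "openin T Q" "x \<in> P" "y \<in> Q" "disjnt P Q"
        using assms(1) y \<open>x \<in> T derived_set_of topspace T\<close>
        unfolding Hausdorff_space_def in_derived_set_of by metis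
      \<comment> \<open>Members of this neighbourhood have two distinct points in \<open>V\<close>,
        so none is in \<open>E V\<close>.\<close>
      let ?O = "{K. compactin T K \<and> K \<inter> (P \<inter> V) \<noteq> {}} \<inter> {K. compactin T K \<and> K \<inter> (Q \<inter> V) \<noteq> {}}"
      have "openin (hyperspace T) ?O"
        using PQ that by (intro openin_Int openin_hyperspace_meets)
      moreover have "insert y K \<in> ?O"
        using \<open>compactin T (insert y K)\<close> x y PQ by auto
      ultimately obtain L where L: "L \<in> E V" "L \<in> ?O"
        using 1 unfolding in_closure_of by meson
      then obtain p q z where "p \<in> L \<inter> (P \<inter> V)" "q \<in> L \<inter> (Q \<inter> V)" "L \<inter> V = {z}"
        unfolding E_def by auto
      then have "p = z" "q = z" by blast+
      then show False
        using PQ(5) \<open>p \<in> _\<close> \<open>q \<in> _\<close> by (auto simp: disjnt_iff)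
    qed
  qed
  have "meager_in (hyperspace T) (\<Union>V\<in>\<B>. E V)"
    using \<B> nd by (intro meager_in_UN nowhere_dense_imp_meager_in) auto
  moreover have "K \<in> (\<Union>V\<in>\<B>. E V)" if K: "K \<in> topspace (hyperspace T)" "T derived_set_of K \<noteq> K" for K
  proof -
    have "closedin T K"
      using K(1) assms(1) by (auto intro: compactin_imp_closedin)
    then have "T derived_set_of K \<subseteq> K"
      by (simp add: closedin_contains_derived_set)
    then obtain x where "x \<in> K" "x \<notin> T derived_set_of K"
      using K(2) by blast
    moreover have "x \<in> topspace T"
      using \<open>x \<in> K\<close> closedin_subset[OF \<open>closedin T K\<close>] by blast
    ultimately obtain U where x: "x \<in> K" "x \<in> U" "openin T U" "K \<inter> U \<subseteq> {x}"
      unfolding in_derived_set_of by blast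
    then obtain V where "V \<in> \<B>" "x \<in> V" "V \<subseteq> U"
      using \<B>(3) by blast
    then have "K \<inter> V = {x}"
      using x(1,4) by blast
    then show ?thesis
      using K(1) \<open>V \<in> \<B>\<close> by (auto simp: E_def)
  qed
  ultimately show ?thesis
    unfolding comeager_in_def by (auto intro!: meager_in_subset[of _ "\<Union>V\<in>\<B>. E V"])
qed

text \<open>The reals inject into every nonempty perfect subset of a locally compact Hausdorff
  space.\<close>

lemma uncountable_perfect:
  assumes "compact_space T" "Hausdorff_space T" "T derived_set_of S = S" "S \<noteq> {}"
  shows "uncountable S"
  using lepoll_perfect_set[of T S] assms compact_imp_locally_compact_space
    countable_lepoll uncountable_UNIV_real by blast

section \<open>Borel isomorphisms that select a point from each compact set\<close>

theorem no_borel_selection_isomorphism: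
  assumes T: "compact_space T" "Hausdorff_space T" "second_countable T"
    and ne: "topspace T \<noteq> {}" and perfect: "T derived_set_of topspace T = topspace T"
    and F: "comeager_in (hyperspace T) F" and G: "comeager_in T G"
    and f: "borel_isomorphism (subtopology (hyperspace T) F) (subtopology T G) f"
    and sel: "\<And>K. K \<in> F \<Longrightarrow> f K \<in> K"
  shows False
proof -
  let ?H = "hyperspace T"
  note H = hyperspace_locally_compact_regular[OF T(1,2)]
  have tF: "topspace (subtopology ?H F) = F" and tG: "topspace (subtopology T G) = G"
    using F G unfolding comeager_in_def by auto
  define g where "g = the_inv_into F f"
  have bij: "bij_betw f F G"
    and g: "g \<in> measurable (borel_of (subtopology T G)) (borel_of (subtopology ?H F))"
    using f unfolding borel_isomorphism_def tF tG g_def by auto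
  have gf: "g (f K) = K" if "K \<in> F" for K
    using bij that by (simp add: g_def bij_betw_def the_inv_into_f_f)
  define B where "B V = {x \<in> G. x \<notin> V \<and> g x \<inter> V \<noteq> {}}" for V
  have BP: "baire_property_in T (B V)" if V: "openin T V" for V
  proof -
    \<comment> \<open>Meeting \<open>V\<close> is an open condition on \<open>K\<close>, so Borel
      measurability of the inverse \<open>g\<close> makes its preimage Borel in \<open>G\<close>,
      and \<open>B V\<close> inherits the Baire property.\<close>
    let ?O = "{K. compactin T K \<and> K \<inter> V \<noteq> {}} \<inter> F"
    have "openin (subtopology ?H F) ?O"
      using openin_hyperspace_meets[OF V] by (auto simp: openin_subtopology)
    then have "?O \<in> sets (borel_of (subtopology ?H F))"
      using openin_subset[of "subtopology ?H F"] unfolding borel_of_def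
      by (subst sets_measure_of) (auto intro: sigma_sets.Basic)
    then have "g -` ?O \<inter> space (borel_of (subtopology T G)) \<in> sets (borel_of (subtopology T G))"
      by (rule measurable_sets[OF g])
    moreover have "space (borel_of (subtopology T G)) = G"
      by (simp only: borel_of_def space_measure_of_conv tG)
    ultimately have "baire_property_in T (g -` ?O \<inter> G)"
      using baire_property_in_borel_of_subtopology[OF baire_property_in_comeager[OF G]] by metis
    moreover have "B V = (g -` ?O \<inter> G) \<inter> (topspace T - V)"
    proof -
      have "g x \<in> F" if "x \<in> G" for x
        using bij that by (metis bij_betw_def g_def order_refl the_inv_into_into)
      moreover have "F \<subseteq> {K. compactin T K}" "G \<subseteq> topspace T"
        using F G by (auto simp: comeager_in_def)
      ultimately show ?thesis
        unfolding B_def by blast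
    qed
    ultimately show ?thesis
      using V by (simp add: baire_property_in_Int baire_property_in_compl baire_property_in_open)
  qed
  obtain \<B> where \<B>: "countable \<B>" "\<And>V. V \<in> \<B> \<Longrightarrow> openin T V"
    "\<And>U x. openin T U \<Longrightarrow> x \<in> U \<Longrightarrow> \<exists>V\<in>\<B>. x \<in> V \<and> V \<subseteq> U"
    using T(3) unfolding second_countable_def by metis
  have fG: "f K \<in> G" if "K \<in> F" for K
    using bij that by (auto simp: bij_betw_def)
  have "\<exists>V\<in>\<B>. \<not> meager_in T (B V)"
  proof (rule ccontr)
    assume "\<not> ?thesis"
    then have "meager_in T (\<Union>V\<in>\<B>. B V)"
      using \<B>(1) by (intro meager_in_UN) auto
    \<comment> \<open>If all \<open>B V\<close> were meager, a generic \<open>K\<close> would be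
      perfect, lie in \<open>F\<close> and miss every \<open>B V\<close>.\<close>
    then have "comeager_in ?H ({K \<in> topspace ?H. K \<inter> (\<Union>V\<in>\<B>. B V) = {}}
        \<inter> ({K \<in> topspace ?H. T derived_set_of K = K} \<inter> F))"
      using T perfect F
      by (intro comeager_in_Int comeager_in_hyperspace_disjoint_meager comeager_in_hyperspace_perfect)
    moreover obtain x where "x \<in> topspace T" using ne by blast
    then have "{x} \<in> topspace ?H" by simp
    ultimately obtain K where K: "K \<in> F" "T derived_set_of K = K" "K \<inter> (\<Union>V\<in>\<B>. B V) = {}"
      using comeager_meets_open[OF H _ openin_topspace] by blast
    let ?x = "f K"
    have x: "?x \<in> T derived_set_of K"
      using K sel by simp
    \<comment> \<open>Perfectness provides a point of \<open>K\<close> other than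
      \<open>f K\<close>. A basic \<open>V\<close> containing it but not \<open>f K\<close> puts
      \<open>f K\<close> into \<open>B V\<close>, since \<open>g (f K) = K\<close> meets
      \<open>V\<close>.\<close>
    then obtain y where y: "y \<in> K" "y \<noteq> ?x"
      unfolding in_derived_set_of by (metis openin_topspace)
    moreover have "y \<in> topspace T" "?x \<in> topspace T"
      using x y K(2) by (auto simp: in_derived_set_of)
    ultimately obtain U where "openin T U" "y \<in> U" "?x \<notin> U"
      using T(2) unfolding Hausdorff_space_def by (metis disjnt_iff)
    then obtain V where "V \<in> \<B>" "y \<in> V" "?x \<notin> V"
      using \<B>(3) by blast
    then have "?x \<in> B V"
      using y(1) gf[OF K(1)] fG[OF K(1)] by (auto simp: B_def)
    then show False
      using K(3) \<open>V \<in> \<B>\<close> sel[OF K(1)] by blast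
  qed
  then obtain V where V: "V \<in> \<B>" "\<not> meager_in T (B V)" by blast
  then obtain W where W: "openin T W" "meager_in T (B V - W)" "meager_in T (W - B V)"
    using BP[OF \<B>(2)] unfolding baire_property_in_def by blast
  have "W \<noteq> {}"
    using V(2) W(2) by auto
  then obtain w where "w \<in> W" by blast
  \<comment> \<open>The singleton shows that the open family of compact subsets of \<open>W\<close>
    is nonempty, so a generic \<open>K\<close> can be found in it.\<close>
  then have "{w} \<in> {K. compactin T K \<and> K \<noteq> {} \<and> K \<subseteq> W}"
    using openin_subset[OF W(1)] by auto
  moreover have "comeager_in ?H ({K \<in> topspace ?H. K \<inter> (W - B V) = {}} \<inter> F)"
    using F W(3) by (intro comeager_in_Int comeager_in_hyperspace_disjoint_meager)
  ultimately obtain K where K: "K \<in> F" "K \<subseteq> W" "K \<inter> (W - B V) = {}"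
    using comeager_meets_open[OF H _ openin_hyperspace_subset[OF W(1)]] by blast
  then have "K \<subseteq> B V" by blast
  \<comment> \<open>Points of \<open>B V\<close> avoid \<open>V\<close>, hence so does all of
    \<open>K\<close>; but \<open>f K \<in> B V\<close> forces \<open>g (f K) = K\<close> to meet
    \<open>V\<close>.\<close>
  then have "K \<inter> V = {}" "f K \<in> B V"
    using sel[OF K(1)] by (auto simp: B_def)
  then show False
    using gf[OF K(1)] by (simp add: B_def)
qed

section \<open>The Cantor space\<close>

lemma compact_space_cantor: "compact_space cantor_space"
  unfolding cantor_space_eq
  by (simp add: compact_space_product_topology compact_space_discrete_topology)

lemma Hausdorff_space_cantor: "Hausdorff_space cantor_space"
  unfolding cantor_space_eq by (simp add: Hausdorff_space_product_topology)

text \<open>A basic open set of the product restricts finitely many coordinates, and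
  \<open>N\<close> bounds all of them.\<close>

lemma cantor_open_contains_cylinder:
  assumes "openin cantor_space U" "x \<in> U"
  shows "\<exists>N. \<forall>y. (\<forall>i<N. y i = x i) \<longrightarrow> y \<in> U"
proof -
  obtain X where X: "x \<in> (\<Pi>\<^sub>E i\<in>UNIV. X i)" "finite {i. X i \<noteq> topspace (discrete_topology UNIV)}"
    "(\<Pi>\<^sub>E i\<in>UNIV. X i) \<subseteq> U"
    using product_topology_open_contains_basis[OF assms(1)[unfolded cantor_space_eq] assms(2)] by blast
  obtain N where N: "\<And>i. X i \<noteq> UNIV \<Longrightarrow> i < N"
    using X(2) by (auto simp: finite_nat_set_iff_bounded)
  have "y \<in> U" if "\<forall>i<N. y i = x i" for y
  proof -
    have "y i \<in> X i" for i
      using X(1) N[of i] that by (cases "X i = UNIV") (auto simp: PiE_iff)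
    then show ?thesis
      using X(3) by auto
  qed
  then show ?thesis by blast
qed

lemma openin_cantor_cylinder: "openin cantor_space {y. \<forall>i<N. y i = x i}"
proof -
  have "openin cantor_space (\<Pi>\<^sub>E i\<in>UNIV. if i < N then {x i} else UNIV)"
    unfolding cantor_space_eq
    by (rule product_topology_basis) (auto intro: finite_subset[of _ "{..<N}"])
  moreover have "(\<Pi>\<^sub>E i\<in>UNIV. if i < N then {x i} else UNIV) = {y. \<forall>i<N. y i = x i}"
    by (auto simp: PiE_iff split: if_splits)
  ultimately show ?thesis by simp
qed

lemma second_countable_cantor: "second_countable cantor_space"
proof -
  \<comment> \<open>Cylinders are indexed by finite words, of which there are countably
    many.\<close>
  let ?B = "\<lambda>xs :: bool list. {y. \<forall>i<length xs. y i = xs ! i}"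
  have "\<exists>V\<in>range ?B. x \<in> V \<and> V \<subseteq> U" if U: "openin cantor_space U" "x \<in> U" for U x
  proof -
    obtain N where N: "\<And>y. \<forall>i<N. y i = x i \<Longrightarrow> y \<in> U"
      using cantor_open_contains_cylinder[OF U] by blast
    have "x \<in> ?B (map x [0..<N]) \<and> ?B (map x [0..<N]) \<subseteq> U"
      using N by auto
    then show ?thesis by (rule bexI) (rule rangeI)
  qed
  moreover have "\<forall>V\<in>range ?B. openin cantor_space V"
    by (intro ballI, elim rangeE, hypsubst) (rule openin_cantor_cylinder)
  ultimately show ?thesis
    unfolding second_countable_def by (intro exI[of _ "range ?B"]) simp
qed

lemma derived_set_of_cantor: "cantor_space derived_set_of UNIV = UNIV"
proof -
  have "\<exists>y. y \<noteq> x \<and> y \<in> U" if U: "openin cantor_space U" "x \<in> U" for x U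
  proof -
    obtain N where N: "\<And>y. \<forall>i<N. y i = x i \<Longrightarrow> y \<in> U"
      using cantor_open_contains_cylinder[OF U] by blast
    \<comment> \<open>Coordinate \<open>N\<close> is the first one that the cylinder leaves free;
      flipping it gives a second point of \<open>U\<close>.\<close>
    have "x(N := \<not> x N) \<noteq> x"
      by (metis fun_upd_same)
    moreover have "x(N := \<not> x N) \<in> U"
      by (rule N) simp
    ultimately show ?thesis by blast
  qed
  then show ?thesis
    by (auto simp: derived_set_of_def)
qed

theorem theorem1p4:
  fixes X :: "(nat \<Rightarrow> bool) set topology"
    and Y :: "(nat \<Rightarrow> bool) topology"
    and A :: "((nat \<Rightarrow> bool) set \<times> (nat \<Rightarrow> bool)) set"
  assumes X: "X = subtopology (vietoris cantor_space) (topspace (vietoris cantor_space) - {{}})"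
    and Y: "Y = cantor_space"
    and A: "A = {(K, x). K \<in> topspace X \<and> x \<in> topspace Y \<and> x \<in> K}"
  shows "closedin (prod_topology X Y) A
    \<and> (\<forall>x \<in> topspace Y. {K. (K, x) \<in> A} = {K \<in> topspace X. x \<in> K}
          \<and> uncountable {K \<in> topspace X. x \<in> K})
    \<and> (\<forall>K \<in> topspace X. {x. (K, x) \<in> A} = K)
    \<and> (\<exists>C. comeager_in X C \<and> (\<forall>K \<in> C. uncountable {x. (K, x) \<in> A}))
    \<and> (\<forall>F G. F \<in> sets (borel_of X) \<and> comeager_in X F
          \<and> G \<in> sets (borel_of Y) \<and> comeager_in Y G
          \<longrightarrow> \<not> (\<exists>f. borel_isomorphism (subtopology X F) (subtopology Y G) f
                 \<and> (\<forall>K \<in> F. (K, f K) \<in> A)))"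
proof -
  have X': "X = hyperspace cantor_space" by (rule X)
  have A': "A = {(K, x). K \<in> topspace X \<and> x \<in> K}"
    unfolding A Y by auto
  have vsec: "{x. (K, x) \<in> A} = K" if "K \<in> topspace X" for K
    using that unfolding A' by auto
  have 1: "closedin (prod_topology X Y) A"
    unfolding A' unfolding X' Y by (rule closedin_membership[OF Hausdorff_space_cantor])
  have 2: "{K. (K, x) \<in> A} = {K \<in> topspace X. x \<in> K} \<and> uncountable {K \<in> topspace X. x \<in> K}" for x
  proof
    show "{K. (K, x) \<in> A} = {K \<in> topspace X. x \<in> K}"
      unfolding A' by auto
    \<comment> \<open>The sets \<open>{x, y}\<close> with varying \<open>y\<close> already give
      uncountably many compact sets containing \<open>x\<close>; the degenerate case
      \<open>y = x\<close> does not spoil injectivity.\<close>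
    have "inj (\<lambda>y. {x, y})"
      by (auto simp: inj_on_def doubleton_eq_iff)
    moreover have "uncountable (UNIV :: (nat \<Rightarrow> bool) set)"
      using uncountable_perfect[OF compact_space_cantor Hausdorff_space_cantor derived_set_of_cantor] by simp
    ultimately have "uncountable (range (\<lambda>y. {x, y}))"
      using countable_image_inj_on by blast
    moreover have "range (\<lambda>y. {x, y}) \<subseteq> {K \<in> topspace X. x \<in> K}"
      unfolding X' by auto
    ultimately show "uncountable {K \<in> topspace X. x \<in> K}"
      using countable_subset by blast
  qed
  have 3: "\<exists>C. comeager_in X C \<and> (\<forall>K \<in> C. uncountable {x. (K, x) \<in> A})"
  proof (intro exI conjI ballI)
    \<comment> \<open>The comeager set is that of perfect compact sets; they are nonempty as points
      of \<open>X\<close>, hence uncountable.\<close>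
    show "comeager_in X {K \<in> topspace X. cantor_space derived_set_of K = K}"
      unfolding X' by (rule comeager_in_hyperspace_perfect)
        (simp_all add: Hausdorff_space_cantor second_countable_cantor derived_set_of_cantor)
    fix K assume K: "K \<in> {K \<in> topspace X. cantor_space derived_set_of K = K}"
    then have "K \<noteq> {}" unfolding X' by auto
    then show "uncountable {x. (K, x) \<in> A}"
      using K vsec uncountable_perfect[OF compact_space_cantor Hausdorff_space_cantor, of K] by simp
  qed
  have 4: False if "comeager_in X F" "comeager_in Y G"
    "borel_isomorphism (subtopology X F) (subtopology Y G) f" "\<forall>K\<in>F. (K, f K) \<in> A" for F G f
  proof (rule no_borel_selection_isomorphism[of cantor_space F G f])
    show "comeager_in (hyperspace cantor_space) F"
      "borel_isomorphism (subtopology (hyperspace cantor_space) F) (subtopology cantor_space G) f"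
      "comeager_in cantor_space G"
      using that unfolding X' Y by simp_all
    show "f K \<in> K" if "K \<in> F" for K
      using that \<open>\<forall>K\<in>F. (K, f K) \<in> A\<close> unfolding A' by auto
  qed (simp_all add: compact_space_cantor Hausdorff_space_cantor second_countable_cantor derived_set_of_cantor)
  show ?thesis
  proof (intro conjI)
    show "\<forall>F G. F \<in> sets (borel_of X) \<and> comeager_in X F \<and> G \<in> sets (borel_of Y) \<and> comeager_in Y G
        \<longrightarrow> \<not> (\<exists>f. borel_isomorphism (subtopology X F) (subtopology Y G) f \<and> (\<forall>K \<in> F. (K, f K) \<in> A))"
      using 4 by meson
  qed (use 1 2 3 vsec in simp_all)
qed

end
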